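(* There exists $n_0$ such that the following holds for every integer $n\ge n_0$ and every real $t=t(n)\ge 2$. Let $G=(V,E)$ be a graph with $|V|=n$ such that for every two disjoint subsets $A,B\subseteq V$ with $|A|,|B|\ge n/t$ there is an edge of $G$ between a vertex of $A$ and a vertex of $B$. Then $G$ admits a cycle of length exactly $k$ for every integer $k\ge 3$ with $$\frac{8n\log n}{t\log\log n}\le k\le n-\frac{3n}{t}.$$
   Context: Graphs are finite and simple. $\log$ is the natural logarithm. The length of a cycle is its number of vertices (equivalently, edges). *)

theory Defs
  imports Complex_Main "Graph_Theory.Graph_Theory"
begin

text \<open>
  A finite simple graph is a \<^locale>\<open>pair_graph\<close>: a finite vertex set with a symmetric,
  irreflexive relation of arcs, an undirected edge being a pair of opposite arcs.
  In this representation \<^const>\<open>pre_digraph.cycle\<close> also accepts the closed walk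
  \<open>a, b, a\<close> of length 2, which is not a cycle of the undirected graph. For lengths
  at least 3 its cycles are exactly the (rooted and oriented) undirected ones, and the length
  of the arc list is the number of edges.
\<close>

end

theory Submission
  imports Defs "HOL-Real_Asymp.Real_Asymp"
begin

text \<open>
  Let \<open>m\<close> be \<open>n / t\<close> rounded up, so that any two disjoint sets of at least \<open>m\<close>
  vertices are joined by an edge. The idea is to build the cycle from a small flexible core and
  one long path whose length can be chosen freely.

  The core is a set \<open>C\<close> of at most \<open>14 * m\<close> vertices with two subsets \<open>A\<close> and \<open>B\<close>
  of size at least \<open>m\<close> such that every \<open>a \<in> A\<close> and \<open>b \<in> B\<close> are the ends of a path
  that visits exactly the vertices of \<open>C\<close>. To find it, take two disjoint sets of \<open>7 * m\<close>
  vertices. Each contains a subgraph in which small sets expand by a factor greater than 2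
  (\<open>joined_contains_expander\<close>). These two subgraphs are joined by an edge \<open>z1 z2\<close>. In each of
  them take a longest path starting at \<open>z1\<close> or \<open>z2\<close>: by Posa's rotations
  (\<open>rotation_ends_few_nbrs\<close>) its vertex set carries paths from the same start to at least
  \<open>m\<close> different ends (\<open>expander_many_ends\<close>). The edge \<open>z1 z2\<close> glues the two families.

  Fewer than \<open>m\<close> vertices outside \<open>C\<close> have no neighbour in \<open>A\<close>; discard them. In the
  remaining set, depth-first search finds a path that starts at a neighbour of \<open>B\<close> and misses
  at most \<open>2 * m - 2\<close> vertices (\<open>depth_first_search_path\<close>). Every vertex of this path is
  adjacent to \<open>A\<close>, so every nonempty initial segment closes to a cycle through all of
  \<open>C\<close>. In total fewer than \<open>3 * m - 2\<close> vertices are lost, so all lengths from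
  \<open>14 * m + 1\<close> to \<open>n - 3 * m + 3\<close> occur (\<open>joined_graph_cycle\<close>).

  It remains to compare the ranges. At the upper end, \<open>3 * (m - 1) < 3 * n / t\<close>. At the lower end,
  \<open>ln n / ln (ln n)\<close> tends to infinity, so for large \<open>n\<close> the hypothesis gives
  \<open>k \<ge> 32 * n / t\<close>, which exceeds \<open>14 * m\<close> as soon as \<open>m \<ge> 2\<close>.
  If \<open>m = 1\<close>, then the graph is complete.
\<close>

section \<open>Paths as vertex lists\<close>

definition path :: "'a rel \<Rightarrow> 'a list \<Rightarrow> bool" where
  "path E xs \<longleftrightarrow> distinct xs \<and> set (vwalk_arcs xs) \<subseteq> E"

lemma path_appendI:
  assumes "path E p" "path E q" "p \<noteq> []" "q \<noteq> []" "set p \<inter> set q = {}" "(last p, hd q) \<in> E"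
  shows "path E (p @ q)"
  using assms by (auto simp: path_def vwalk_arcs_append)

lemma path_appendD:
  assumes "path E (p @ q)"
  shows "path E p" "path E q" "p \<noteq> [] \<Longrightarrow> q \<noteq> [] \<Longrightarrow> (last p, hd q) \<in> E"
  using assms by (cases "p = []"; cases "q = []"; simp add: path_def vwalk_arcs_append)+

lemma path_rev:
  assumes "sym E" "path E p"
  shows "path E (rev p)"
  using assms by (auto simp: path_def set_vwalk_arcs_rev dest: symD)

lemma path_singleton: "path E [x]"
  by (simp add: path_def)

text \<open>
  In a list without repetitions the arcs form a partial function.
\<close>

lemma card_arc_successors:
  assumes "distinct xs" "finite R"
  shows "card (set (vwalk_arcs xs) `` R) \<le> card R"
proof -
  have uniq: "v = v'" if "(u, v) \<in> set (vwalk_arcs xs)" "(u, v') \<in> set (vwalk_arcs xs)" for u v v'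
    using that assms(1)
    by (induction xs rule: vwalk_arcs.induct) (auto elim: in_set_vwalk_arcsE)
  have "set (vwalk_arcs xs) `` R \<subseteq> (\<lambda>u. THE v. (u, v) \<in> set (vwalk_arcs xs)) ` R"
  proof
    fix v assume "v \<in> set (vwalk_arcs xs) `` R"
    then obtain u where u: "u \<in> R" "(u, v) \<in> set (vwalk_arcs xs)" by auto
    then have "(THE v. (u, v) \<in> set (vwalk_arcs xs)) = v" using uniq by blast
    with u show "v \<in> (\<lambda>u. THE v. (u, v) \<in> set (vwalk_arcs xs)) ` R" by blast
  qed
  then show ?thesis using assms(2) by (meson card_image_le card_mono finite_imageI le_trans)
qed

text \<open>
  Adjacency along the list, without orientation: reversing a segment keeps the links inside it.
\<close>

definition links :: "'a list \<Rightarrow> 'a rel" where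
  "links xs = set (vwalk_arcs xs) \<union> (set (vwalk_arcs xs))\<inverse>"

lemma card_links_Image:
  assumes "distinct xs" "finite R"
  shows "card (links xs `` R) \<le> 2 * card R"
proof -
  have "links xs `` R = set (vwalk_arcs xs) `` R \<union> set (vwalk_arcs (rev xs)) `` R"
    by (auto simp: links_def set_vwalk_arcs_rev)
  then show ?thesis
    using card_arc_successors[of xs R] card_arc_successors[of "rev xs" R] assms
      card_Un_le[of "set (vwalk_arcs xs) `` R" "set (vwalk_arcs (rev xs)) `` R"]
    by simp
qed

lemma cycle_of_path:
  assumes "pair_graph G" "path (parcs G) xs" "set xs \<subseteq> pverts G" "xs \<noteq> []"
    "(last xs, hd xs) \<in> parcs G"
  shows "\<exists>p. pre_digraph.cycle (with_proj G) p \<and> length p = length xs"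
proof -
  interpret pair_graph G by fact
  have cas: "ys \<noteq> [] \<Longrightarrow> pcas (hd ys) (vwalk_arcs ys) (last ys)" for ys :: "'a list"
    by (induction ys rule: vwalk_arcs.induct) auto
  have verts: "ys \<noteq> [] \<Longrightarrow> pawalk_verts (hd ys) (vwalk_arcs ys) = ys" for ys :: "'a list"
    by (induction ys rule: vwalk_arcs.induct) auto
  define ys where "ys = xs @ [hd xs]"
  have ys: "ys \<noteq> []" "hd ys = hd xs" "last ys = hd xs" using assms(4) by (auto simp: ys_def)
  have arcs: "set (vwalk_arcs ys) \<subseteq> parcs G"
    using assms(2,4,5) by (auto simp: ys_def path_def vwalk_arcs_append)
  have len: "length (vwalk_arcs ys) = length xs"
    using vwalk_length_simp[of ys] unfolding vwalk_length_def by (simp add: ys_def)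
  have "awalk (hd xs) (vwalk_arcs ys) (hd xs)"
    using cas[OF ys(1)] arcs assms(3,4) ys unfolding awalk_def by auto
  moreover have "distinct (tl (pawalk_verts (hd xs) (vwalk_arcs ys)))"
    using verts[OF ys(1)] ys assms(2,4) by (cases xs) (auto simp: path_def ys_def)
  moreover have "vwalk_arcs ys \<noteq> []" using len assms(4) by auto
  ultimately have "cycle (vwalk_arcs ys)" unfolding cycle_def by auto
  with len show ?thesis by blast
qed

section \<open>Posa rotations\<close>

text \<open>
  Posa's rotation with the first vertex fixed: if the last vertex is adjacent to \<open>v\<close>, reversing
  everything after \<open>v\<close> gives a path on the same vertices that ends at the old successor
  of \<open>v\<close>.
\<close>

inductive rotation :: "'a rel \<Rightarrow> 'a list \<Rightarrow> 'a list \<Rightarrow> bool" for E xs where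
  refl: "rotation E xs xs"
| step: "rotation E xs (as @ [v] @ bs) \<Longrightarrow> bs \<noteq> [] \<Longrightarrow> (last bs, v) \<in> E
    \<Longrightarrow> rotation E xs (as @ [v] @ rev bs)"

lemma rotation_path:
  assumes "rotation E xs ys" "sym E" "path E xs"
  shows "path E ys \<and> set ys = set xs \<and> hd ys = hd xs"
  using assms
proof induction
  case (step as v bs)
  then have IH: "path E (as @ [v] @ bs)" "set (as @ [v] @ bs) = set xs" "hd (as @ [v] @ bs) = hd xs"
    by auto
  have parts: "path E (as @ [v])" "path E bs"
    using path_appendD[of E "as @ [v]" bs] IH(1) by auto
  have "path E ((as @ [v]) @ rev bs)"
  proof (rule path_appendI)
    show "path E (as @ [v])" "path E (rev bs)"
      using parts path_rev[OF step.prems(1)] by simp_all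
    show "(last (as @ [v]), hd (rev bs)) \<in> E"
      using step.hyps step.prems(1) by (simp add: hd_rev symD)
    show "set (as @ [v]) \<inter> set (rev bs) = {}" using IH(1) by (auto simp: path_def)
  qed (use step.hyps in auto)
  then show ?case using IH by (auto simp: hd_append)
qed auto

abbreviation rotation_ends :: "'a rel \<Rightarrow> 'a list \<Rightarrow> 'a set" where
  "rotation_ends E xs \<equiv> last ` Collect (rotation E xs)"

lemma rotation_endsI: "rotation E xs ys \<Longrightarrow> last ys \<in> rotation_ends E xs"
  by blast

text \<open>
  A rotation at \<open>w\<close> breaks the link from \<open>w\<close> to its successor and creates one from \<open>w\<close> to
  the old end. Both the successor and the old end are rotation ends. Hence a vertex \<open>v\<close> that
  neither is a rotation end nor was linked to one in \<open>xs\<close> never takes part: if it were \<open>w\<close>, its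
  successor would be a rotation end, and by induction the two were already linked in \<open>xs\<close>.
\<close>

lemma rotation_preserves_far_arcs:
  assumes "rotation E xs ys"
    and "v \<notin> rotation_ends E xs"
    and "v \<notin> links xs `` (rotation_ends E xs)"
    and "(u, v) \<in> links ys"
  shows "(u, v) \<in> links xs"
  using assms(1,4)
proof (induction arbitrary: u)
  case (step as w bs)
  let ?R = "rotation_ends E xs"
  have rot: "rotation E xs (as @ [w] @ rev bs)" using step.hyps by (rule rotation.step)
  have R: "last bs \<in> ?R" "hd bs \<in> ?R"
    using rotation_endsI[OF step.hyps(1)] rotation_endsI[OF rot] step.hyps(2)
    by (simp_all add: last_rev)
  have old: "set (vwalk_arcs (as @ [w] @ bs))
      = set (vwalk_arcs (as @ [w])) \<union> {(w, hd bs)} \<union> set (vwalk_arcs bs)"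
    using step.hyps(2) vwalk_arcs_append[of "as @ [w]" bs] by auto
  have new: "set (vwalk_arcs (as @ [w] @ rev bs))
      = set (vwalk_arcs (as @ [w])) \<union> {(w, last bs)} \<union> (set (vwalk_arcs bs))\<inverse>"
    using step.hyps(2) vwalk_arcs_append[of "as @ [w]" "rev bs"]
    by (auto simp: set_vwalk_arcs_rev hd_rev)
  have "v \<noteq> w"
  proof
    assume "v = w"
    then have "(hd bs, v) \<in> links xs"
      using step.IH[of "hd bs"] old by (auto simp: links_def)
    with R(2) assms(3) show False by blast
  qed
  moreover have "v \<noteq> last bs" using R(1) assms(2) by metis
  ultimately have "(u, v) \<in> links (as @ [w] @ bs)"
    using step.prems unfolding links_def old new by auto
  then show ?case by (rule step.IH)
qed

definition ext_nbrs :: "'a rel \<Rightarrow> 'a set \<Rightarrow> 'a set \<Rightarrow> 'a set" where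
  "ext_nbrs E U X = E `` X \<inter> U - X"

text \<open>
  Posa's lemma. By maximality a neighbour \<open>v\<close> of a rotation end lies on the path, and
  rotating at \<open>v\<close> makes its current successor a rotation end. If \<open>v\<close> is itself no rotation end, then
  by \<open>rotation_preserves_far_arcs\<close> it was linked to a rotation end in the original path, and
  each rotation end has at most two links there.
\<close>

lemma rotation_ends_few_nbrs:
  assumes "sym E" "path E xs" "xs \<noteq> []" "set xs \<subseteq> U" "finite U"
    and longest: "\<And>ys. path E ys \<Longrightarrow> hd ys = hd xs \<Longrightarrow> set ys \<subseteq> U \<Longrightarrow> length ys \<le> length xs"
  shows "card (ext_nbrs E U (rotation_ends E xs)) \<le> 2 * card (rotation_ends E xs)"
proof -
  let ?R = "rotation_ends E xs"
  have rot: "path E ys" "set ys = set xs" "hd ys = hd xs" "ys \<noteq> []" "length ys = length xs"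
    if "rotation E xs ys" for ys
  proof -
    show "path E ys" "set ys = set xs" "hd ys = hd xs"
      using rotation_path[OF that assms(1,2)] by simp_all
    then show "ys \<noteq> []" "length ys = length xs"
      using assms(2,3) distinct_card[of xs] distinct_card[of ys] by (auto simp: path_def)
  qed
  have "last ys \<in> U" if "rotation E xs ys" for ys
    using rot(2,4)[OF that] last_in_set[of ys] assms(4) by blast
  then have R: "?R \<subseteq> U" by blast
  then have fin: "finite ?R" using assms(5) finite_subset by blast
  have "ext_nbrs E U ?R \<subseteq> links xs `` ?R"
  proof
    fix v assume "v \<in> ext_nbrs E U ?R"
    then obtain ys where ys: "rotation E xs ys" "(last ys, v) \<in> E" and v: "v \<in> U" "v \<notin> ?R"
      unfolding ext_nbrs_def by blast
    have "v \<in> set ys"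
    proof (rule ccontr)
      assume "v \<notin> set ys"
      then have "path E (ys @ [v])"
        using rot[OF ys(1)] ys(2) by (intro path_appendI) (auto simp: path_singleton)
      then have "length (ys @ [v]) \<le> length xs"
        using rot[OF ys(1)] v assms(4) by (intro longest) auto
      then show False using rot[OF ys(1)] by simp
    qed
    then obtain as bs where split: "ys = as @ [v] @ bs" by (auto simp: in_set_conv_decomp)
    have "last ys \<noteq> v" using ys(1) v(2) by blast
    then have bs: "bs \<noteq> []" "last ys = last bs" using split by auto
    have "rotation E xs (as @ [v] @ rev bs)"
      using ys bs split by (intro rotation.step) auto
    from rotation_endsI[OF this] have hd: "hd bs \<in> ?R"
      using bs by (simp add: last_rev)
    have "(hd bs, v) \<in> links ys"
      using bs vwalk_arcs_append[of "as @ [v]" bs] unfolding split links_def by auto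
    then show "v \<in> links xs `` ?R"
      using rotation_preserves_far_arcs[OF ys(1) v(2)] hd by blast
  qed
  moreover have "links xs `` ?R \<subseteq> set xs"
    by (auto simp: links_def elim: in_set_vwalk_arcsE)
  then have "finite (links xs `` ?R)" by (rule finite_subset) simp
  ultimately have "card (ext_nbrs E U ?R) \<le> card (links xs `` ?R)"
    by (rule card_mono[rotated])
  also have "\<dots> \<le> 2 * card ?R"
    using assms(2) fin by (intro card_links_Image) (auto simp: path_def)
  finally show ?thesis .
qed

text \<open>
  The factor 2 is the bound that Posa's lemma puts on the neighbourhood of the rotation ends.
\<close>

definition expander :: "'a rel \<Rightarrow> 'a set \<Rightarrow> nat \<Rightarrow> bool" where
  "expander E U m \<longleftrightarrow>
    (\<forall>X \<subseteq> U. X \<noteq> {} \<and> card X < m \<longrightarrow> 2 * card X < card (ext_nbrs E U X))"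

text \<open>
  The set of rotation ends of a longest path from \<open>z\<close> fails to expand, so it cannot be small.
\<close>

lemma expander_many_ends:
  assumes "sym E" "finite U" "z \<in> U" "expander E U m"
  obtains C A where "C \<subseteq> U" "z \<in> C" "A \<subseteq> C" "m \<le> card A"
    "\<forall>a\<in>A. \<exists>p. path E p \<and> p \<noteq> [] \<and> set p = C \<and> hd p = z \<and> last p = a"
proof -
  let ?P = "\<lambda>p. path E p \<and> p \<noteq> [] \<and> hd p = z \<and> set p \<subseteq> U"
  have "length p < Suc (card U)" if "?P p" for p
    using that assms(2) card_mono[of U "set p"] by (auto simp: path_def distinct_card)
  moreover have "?P [z]" using assms(3) by (simp add: path_singleton)
  ultimately have "\<exists>xs. ?P xs \<and> (\<forall>ys. ?P ys \<longrightarrow> length ys \<le> length xs)"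
    by (intro ex_has_greatest_nat[where k = "[z]" and b = "Suc (card U)"]) simp_all
  then obtain xs where max: "?P xs \<and> (\<forall>ys. ?P ys \<longrightarrow> length ys \<le> length xs)"
    by (rule exE)
  note xs = conjunct1[OF max] and longest = conjunct2[OF max]
  let ?R = "rotation_ends E xs"
  have rot: "path E ys \<and> ys \<noteq> [] \<and> set ys = set xs \<and> hd ys = z" if "rotation E xs ys" for ys
    using rotation_path[OF that assms(1)] xs by auto
  have "last ys \<in> set xs" if "rotation E xs ys" for ys
    using rot[OF that] last_in_set[of ys] by simp
  then have R: "?R \<subseteq> set xs" by blast
  have "card (ext_nbrs E U ?R) \<le> 2 * card ?R"
  proof (rule rotation_ends_few_nbrs)
    fix ys assume "path E ys" "hd ys = hd xs" "set ys \<subseteq> U"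
    then show "length ys \<le> length xs" using longest xs by (cases "ys = []") auto
  qed (use assms xs in auto)
  moreover have "?R \<noteq> {}" using rotation.refl by blast
  moreover have "?R \<subseteq> U" using R xs by blast
  ultimately have "m \<le> card ?R"
    using assms(4) unfolding expander_def by (metis linorder_not_le)
  moreover have "\<exists>p. path E p \<and> p \<noteq> [] \<and> set p = set xs \<and> hd p = z \<and> last p = a" if "a \<in> ?R" for a
  proof -
    obtain ys where "rotation E xs ys" "a = last ys" using \<open>a \<in> ?R\<close> by (elim imageE CollectE)
    with rot[of ys] show ?thesis by (intro exI[of _ ys]) simp
  qed
  moreover have "z \<in> set xs" using xs by force
  ultimately show thesis using xs R by (intro that[of "set xs" ?R]) simp_all
qed

section \<open>Expanders inside joined graphs\<close>

definition joined :: "'a rel \<Rightarrow> 'a set \<Rightarrow> nat \<Rightarrow> bool" where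
  "joined E V m \<longleftrightarrow> (\<forall>A B. A \<subseteq> V \<and> B \<subseteq> V \<and> A \<inter> B = {} \<and> m \<le> card A \<and> m \<le> card B
    \<longrightarrow> (\<exists>a\<in>A. \<exists>b\<in>B. (a, b) \<in> E))"

lemma joinedD:
  assumes "joined E V m" "A \<subseteq> V" "B \<subseteq> V" "A \<inter> B = {}" "m \<le> card A" "m \<le> card B"
  shows "E `` A \<inter> B \<noteq> {}"
  using assms(1)[unfolded joined_def, rule_format, of A B] assms(2-6) by auto

lemma joined_mono:
  assumes "joined E V m" "U \<subseteq> V"
  shows "joined E U m"
  unfolding joined_def
proof (intro allI impI)
  fix A B assume AB: "A \<subseteq> U \<and> B \<subseteq> U \<and> A \<inter> B = {} \<and> m \<le> card A \<and> m \<le> card B"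
  then have "A \<subseteq> V" "B \<subseteq> V" using assms(2) by auto
  with AB show "\<exists>a\<in>A. \<exists>b\<in>B. (a, b) \<in> E"
    using assms(1)[unfolded joined_def, rule_format, of A B] by simp
qed

text \<open>
  Remove a largest set \<open>D\<close> of fewer than \<open>m\<close> vertices that does not expand. If some small \<open>X\<close>
  did not expand in the rest, then neither would \<open>D \<union> X\<close>, so by the choice of \<open>D\<close> this union
  would have between \<open>m\<close> and \<open>2 * m\<close> vertices. Together with its neighbourhood it would cover fewer than
  \<open>6 * m\<close> vertices, which leaves at least \<open>m\<close> vertices not joined to it.
\<close>

lemma joined_contains_expander:
  assumes "finite U" "joined E U m" "0 < m" "7 * m \<le> card U"
  obtains U' where "U' \<subseteq> U" "card U < card U' + m" "expander E U' m"
proof -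
  let ?P = "\<lambda>D. D \<subseteq> U \<and> card D < m \<and> card (ext_nbrs E U D) \<le> 2 * card D"
  have "?P {}" using assms(3) by (simp add: ext_nbrs_def)
  moreover have "card D < m" if "?P D" for D using that by simp
  ultimately have "\<exists>D. ?P D \<and> (\<forall>D'. ?P D' \<longrightarrow> card D' \<le> card D)"
    by (intro ex_has_greatest_nat[where k = "{}" and b = m]) simp_all
  then obtain D where D_max: "?P D \<and> (\<forall>D'. ?P D' \<longrightarrow> card D' \<le> card D)"
    by (rule exE)
  note D = conjunct1[OF D_max] and max = conjunct2[OF D_max]
  have finD: "finite D" using D assms(1) finite_subset by blast
  have "expander E (U - D) m"
    unfolding expander_def
  proof (intro allI impI, rule ccontr)
    fix X assume X: "X \<subseteq> U - D" "X \<noteq> {} \<and> card X < m"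
      and "\<not> 2 * card X < card (ext_nbrs E (U - D) X)"
    then have small: "card (ext_nbrs E (U - D) X) \<le> 2 * card X" by simp
    have finX: "finite X" using X assms(1) finite_subset by blast
    have card: "card (D \<union> X) = card D + card X" using X finX finD by (intro card_Un_disjoint) auto
    have finN: "finite (ext_nbrs E U D)" "finite (ext_nbrs E (U - D) X)"
      using assms(1) by (auto simp: ext_nbrs_def)
    have "ext_nbrs E U (D \<union> X) \<subseteq> ext_nbrs E U D \<union> ext_nbrs E (U - D) X"
      by (auto simp: ext_nbrs_def)
    then have "card (ext_nbrs E U (D \<union> X)) \<le> card (ext_nbrs E U D \<union> ext_nbrs E (U - D) X)"
      using finN by (intro card_mono) auto
    also have "\<dots> \<le> card (ext_nbrs E U D) + card (ext_nbrs E (U - D) X)"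
      by (rule card_Un_le)
    finally have "card (ext_nbrs E U (D \<union> X)) \<le> card (ext_nbrs E U D) + card (ext_nbrs E (U - D) X)" .
    then have N: "card (ext_nbrs E U (D \<union> X)) \<le> 2 * card (D \<union> X)"
      using small D card by simp
    have "0 < card X" using X finX by (simp add: card_gt_0_iff)
    have big: "m \<le> card (D \<union> X)"
    proof (rule ccontr)
      assume "\<not> m \<le> card (D \<union> X)"
      moreover have "D \<union> X \<subseteq> U" using D X(1) by auto
      ultimately have "card (D \<union> X) \<le> card D" using N by (intro max[rule_format]) simp
      then show False using card \<open>0 < card X\<close> by simp
    qed
    let ?Y = "U - (D \<union> X) - ext_nbrs E U (D \<union> X)"
    have "card U \<le> card ?Y + card (D \<union> X) + card (ext_nbrs E U (D \<union> X))"
    proof -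
      have "finite (ext_nbrs E U (D \<union> X))" using assms(1) by (simp add: ext_nbrs_def)
      then show ?thesis
        using diff_card_le_card_Diff[of "D \<union> X" U] finX finD
          diff_card_le_card_Diff[of "ext_nbrs E U (D \<union> X)" "U - (D \<union> X)"] by simp
    qed
    moreover have "card D < m" "card X < m" using D X(2) by simp_all
    ultimately have "m \<le> card ?Y" using assms(4) N card by linarith
    moreover have "D \<union> X \<subseteq> U" "?Y \<subseteq> U" "(D \<union> X) \<inter> ?Y = {}" using D X(1) by auto
    ultimately have "E `` (D \<union> X) \<inter> ?Y \<noteq> {}"
      using big by (intro joinedD[OF assms(2)]) simp_all
    then show False by (auto simp: ext_nbrs_def)
  qed
  moreover have "card U < card (U - D) + m"
    using D finD card_Diff_subset[of D U] card_mono[OF assms(1), of D] by auto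
  ultimately show thesis using that[of "U - D"] by blast
qed

section \<open>Long paths by depth-first search\<close>

text \<open>
  Depth-first search in \<open>W\<close>, with \<open>B\<close> acting as the root, maintains the unvisited vertices \<open>S\<close>,
  the finished vertices \<open>T\<close> and the current path \<open>q\<close>; no edge leads from \<open>T\<close> to \<open>S\<close>.
  Each step lowers \<open>card S - card T\<close> by exactly 1, so at some moment the two sets have the same
  size. This size is less than \<open>m\<close> because no edge joins them, and \<open>q\<close> contains all
  other vertices of \<open>W\<close>.
\<close>

lemma depth_first_search_path:
  assumes "finite W" "W \<inter> B = {}" "joined E (W \<union> B) m" "m \<le> card B"
    and "0 < k" "k + 2 * m \<le> card W + 2"
  obtains q b where "path E q" "set q \<subseteq> W" "length q = k" "b \<in> B" "(b, hd q) \<in> E"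
proof -
  define inv where "inv = (\<lambda>S T q. W = S \<union> T \<union> set q \<and> S \<inter> T = {} \<and> S \<inter> set q = {} \<and> T \<inter> set q = {}
    \<and> E `` T \<inter> S = {} \<and> path E q \<and> (q \<noteq> [] \<longrightarrow> hd q \<in> E `` B))"
  \<comment> \<open>After \<open>i\<close> steps the difference \<open>card S - card T\<close> has dropped from \<open>card W\<close> by \<open>i\<close>.\<close>
  have "\<exists>S T q. inv S T q \<and> card S + i = card T + card W" if "i \<le> card W" for i
    using that
  proof (induction i)
    case 0
    have "inv W {} []" by (simp add: inv_def path_def)
    then show ?case by fastforce
  next
    case (Suc i)
    then obtain S T q where inv: "inv S T q" and c: "card S + i = card T + card W" by force
    then have fin: "finite S" "finite T" using assms(1) by (auto simp: inv_def)
    have push: "\<exists>S T q. inv S T q \<and> card S + Suc i = card T + card W"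
      if "s \<in> S" "inv (S - {s}) T (q @ [s])" for s
    proof -
      have "card (S - {s}) + 1 = card S" using card_Suc_Diff1[OF fin(1) that(1)] by linarith
      then have "card (S - {s}) + Suc i = card T + card W" using c by simp
      with that show ?thesis by blast
    qed
    show ?case
    proof (cases q rule: rev_cases)
      case Nil
      \<comment> \<open>The path is empty, so the search needs a new start next to \<open>B\<close>. As \<open>S\<close> is more than half of
        \<open>W\<close>, it has at least \<open>m\<close> vertices and is joined to \<open>B\<close>.\<close>
      have "E `` B \<inter> S \<noteq> {}"
      proof
        assume none: "E `` B \<inter> S = {}"
        have "card W = card S + card T"
          using inv Nil fin by (auto simp: inv_def card_Un_disjoint)
        then have "m \<le> card S" using c Suc.prems assms(5,6) by linarith
        moreover have "S \<subseteq> W" using inv by (auto simp: inv_def)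
        ultimately have "E `` B \<inter> S \<noteq> {}"
          using assms(2,4) by (intro joinedD[OF assms(3)]) auto
        with none show False by simp
      qed
      then obtain s where s: "s \<in> E `` B" "s \<in> S" by blast
      then have "inv (S - {s}) T (q @ [s])"
        using inv Nil by (auto simp: inv_def path_singleton)
      with s show ?thesis using push by blast
    next
      case (snoc q' x)
      show ?thesis
      proof (cases "E `` {x} \<inter> S = {}")
        case True
        have "inv S (insert x T) q'"
          using inv True path_appendD(1)[of E q' "[x]"] unfolding snoc inv_def
          by (auto simp: path_def hd_append split: if_splits)
        moreover have "x \<notin> T" using inv snoc by (auto simp: inv_def)
        then have "card S + Suc i = card (insert x T) + card W" using c fin by simp
        ultimately show ?thesis by blast
      next
        case False
        then obtain s where s: "s \<in> S" "(x, s) \<in> E" by blast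
        then have "path E (q @ [s])"
          using inv snoc by (intro path_appendI[of E q]) (auto simp: inv_def path_singleton)
        then have "inv (S - {s}) T (q @ [s])"
          using inv s snoc by (auto simp: inv_def hd_append)
        with s show ?thesis using push by blast
      qed
    qed
  qed
  from this[OF order_refl] obtain S T q where inv: "inv S T q" and c: "card S = card T" by auto
  then have fin: "finite S" "finite T" using assms(1) by (auto simp: inv_def)
  have "card S < m"
  proof (rule ccontr)
    assume "\<not> card S < m"
    moreover have "T \<subseteq> W" "S \<subseteq> W" "T \<inter> S = {}" using inv by (auto simp: inv_def)
    ultimately have "E `` T \<inter> S \<noteq> {}"
      using c by (intro joinedD[OF assms(3)]) auto
    then show False using inv by (simp add: inv_def)
  qed
  moreover have "card W = card S + card T + length q"
    using inv fin by (auto simp: inv_def card_Un_disjoint path_def distinct_card Int_Un_distrib2)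
  ultimately have k: "k \<le> length q" using assms(6) c by linarith
  have "path E (take k q)" using path_appendD(1)[of E "take k q" "drop k q"] inv by (simp add: inv_def)
  moreover have "set (take k q) \<subseteq> W" using inv set_take_subset[of k q] by (auto simp: inv_def)
  moreover have "hd (take k q) \<in> E `` B" using inv k assms(5) by (auto simp: inv_def)
  ultimately show thesis using that k by auto
qed

section \<open>Cycles of prescribed length\<close>

text \<open>
  The cycle runs from \<open>a \<in> A\<close> through \<open>C1\<close> to \<open>z1\<close>, over the edge to \<open>z2\<close>, through \<open>C2\<close> to \<open>b \<in> B\<close>,
  and back to \<open>a\<close> along a path \<open>q\<close> outside the core. The core part has \<open>card C1 + card C2\<close> vertices
  whatever \<open>a\<close> and \<open>b\<close> are, so the length of \<open>q\<close> can be fixed before its ends are known.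
\<close>

theorem joined_graph_cycle:
  assumes "sym E" "finite V" "joined E V m" "0 < m" "14 * m < k" "k + 3 * m \<le> card V + 3"
  obtains xs where "path E xs" "set xs \<subseteq> V" "length xs = k" "(last xs, hd xs) \<in> E"
proof -
  have "14 * m \<le> card V" using assms(4-6) by linarith
  then obtain U where U: "U \<subseteq> V" "card U = 14 * m" by (meson obtain_subset_with_card_n)
  have "7 * m \<le> card U" using U(2) by simp
  then obtain U1 where U1: "U1 \<subseteq> U" "card U1 = 7 * m"
    by (rule obtain_subset_with_card_n)
  define U2 where "U2 = U - U1"
  have fin: "finite U" "finite U1"
    using finite_subset[OF U(1) assms(2)] finite_subset[OF U1(1)] by simp_all
  have U2: "card U2 = 7 * m" using U U1 fin by (simp add: U2_def card_Diff_subset)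
  have jU: "joined E U1 m" "joined E U2 m"
    using U U1 by (auto intro!: joined_mono[OF assms(3)] simp: U2_def)
  obtain X1 where X1: "X1 \<subseteq> U1" "card U1 < card X1 + m" "expander E X1 m"
    using joined_contains_expander[OF fin(2) jU(1) assms(4)] U1(2) by auto
  have "finite U2" using fin by (simp add: U2_def)
  then obtain X2 where X2: "X2 \<subseteq> U2" "card U2 < card X2 + m" "expander E X2 m"
    using joined_contains_expander[OF _ jU(2) assms(4)] U2 by auto
  have sub: "X1 \<subseteq> V" "X2 \<subseteq> V" and disj: "X1 \<inter> X2 = {}"
    using X1(1) X2(1) U(1) U1(1) by (auto simp: U2_def)
  have finX: "finite X1" "finite X2" using sub assms(2) by (simp_all add: finite_subset)
  have big: "m \<le> card X1" "m \<le> card X2" using U1(2) U2 X1(2) X2(2) assms(4) by linarith+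
  obtain z1 z2 where z: "z1 \<in> X1" "z2 \<in> X2" "(z1, z2) \<in> E"
    using joinedD[OF assms(3) sub disj big] by blast
  obtain C1 A where C1: "C1 \<subseteq> X1" "z1 \<in> C1" "A \<subseteq> C1" "m \<le> card A"
    and pathA: "\<forall>a\<in>A. \<exists>p. path E p \<and> p \<noteq> [] \<and> set p = C1 \<and> hd p = z1 \<and> last p = a"
    by (rule expander_many_ends[OF assms(1) finX(1) z(1) X1(3)])
  obtain C2 B where C2: "C2 \<subseteq> X2" "z2 \<in> C2" "B \<subseteq> C2" "m \<le> card B"
    and pathB: "\<forall>b\<in>B. \<exists>p. path E p \<and> p \<noteq> [] \<and> set p = C2 \<and> hd p = z2 \<and> last p = b"
    by (rule expander_many_ends[OF assms(1) finX(2) z(2) X2(3)])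
  have finC: "finite C1" "finite C2" using C1(1) C2(1) finX by (simp_all add: finite_subset)
  have c: "card (C1 \<union> C2) = card C1 + card C2" using C1 C2 disj finC by (intro card_Un_disjoint) auto
  have CU: "C1 \<union> C2 \<subseteq> U" using C1 C2 X1 X2 U1 by (auto simp: U2_def)
  then have c14: "card C1 + card C2 \<le> 14 * m" using U(2) fin c card_mono[of U "C1 \<union> C2"] by simp
  define D where "D = V - (C1 \<union> C2) - E `` A"
  \<comment> \<open>\<open>D\<close> has to go: a path that ended in it could not be closed through \<open>A\<close>.\<close>
  have "card D < m"
  proof (rule ccontr)
    assume "\<not> card D < m"
    moreover have "A \<subseteq> V" "D \<subseteq> V" "A \<inter> D = {}" using C1(1,3) sub by (auto simp: D_def)
    ultimately have "E `` A \<inter> D \<noteq> {}" using C1(4) by (intro joinedD[OF assms(3)]) auto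
    then show False by (auto simp: D_def)
  qed
  define W where "W = V - (C1 \<union> C2) - D"
  have "finite D" "D \<subseteq> V - (C1 \<union> C2)" using assms(2) by (auto simp: D_def)
  then have "card W = card (V - (C1 \<union> C2)) - card D"
    unfolding W_def by (rule card_Diff_subset)
  also have "card (V - (C1 \<union> C2)) = card V - (card C1 + card C2)"
    using CU U(1) c finC by (subst card_Diff_subset) auto
  finally have "card W = card V - (card C1 + card C2) - card D" .
  then have k: "0 < k - (card C1 + card C2)" "k - (card C1 + card C2) + 2 * m \<le> card W + 2"
    using \<open>card D < m\<close> assms(5,6) c14 by linarith+
  have "W \<union> B \<subseteq> V" using C2(1,3) sub(2) by (auto simp: W_def)
  then have "joined E (W \<union> B) m" by (rule joined_mono[OF assms(3)])
  moreover have "finite W" "W \<inter> B = {}" using assms(2) C2(3) by (auto simp: W_def)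
  ultimately obtain q b where q: "path E q" "set q \<subseteq> W" "length q = k - (card C1 + card C2)"
    and b: "b \<in> B" "(b, hd q) \<in> E"
    using depth_first_search_path[OF _ _ _ C2(4) k] by metis
  have qne: "q \<noteq> []" using q(3) k(1) by auto
  then have "last q \<in> W" using q(2) last_in_set by blast
  then have "last q \<in> E `` A" by (auto simp: W_def D_def)
  then obtain a where a: "a \<in> A" "(last q, a) \<in> E" using assms(1) by (auto dest: symD)
  obtain p1 where p1: "path E p1" "p1 \<noteq> []" "set p1 = C1" "hd p1 = z1" "last p1 = a"
    using bspec[OF pathA a(1)] by (elim exE conjE)
  obtain p2 where p2: "path E p2" "p2 \<noteq> []" "set p2 = C2" "hd p2 = z2" "last p2 = b"
    using bspec[OF pathB b(1)] by (elim exE conjE)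
  have "path E (p2 @ q)"
    using p2 q qne b by (intro path_appendI) (auto simp: W_def)
  then have "path E (rev p1 @ p2 @ q)"
  proof (rule path_appendI[OF path_rev[OF assms(1) p1(1)]])
    show "set (rev p1) \<inter> set (p2 @ q) = {}"
      using p1(3) p2(3) q(2) C1(1) C2(1) disj by (auto simp: W_def)
    show "(last (rev p1), hd (p2 @ q)) \<in> E" using p1(2,4) p2(2,4) z(3) by (simp add: last_rev)
  qed (use p1(2) p2(2) in simp_all)
  moreover have "length (rev p1 @ p2 @ q) = k"
    using p1 p2 q(3) k(1) distinct_card[of p1] distinct_card[of p2] by (auto simp: path_def)
  moreover have "set (rev p1 @ p2 @ q) \<subseteq> V"
    using p1 p2 q C1 C2 sub by (auto simp: W_def)
  moreover have "(last (rev p1 @ p2 @ q), hd (rev p1 @ p2 @ q)) \<in> E"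
    using p1 qne a by (simp add: hd_rev)
  ultimately show thesis using that by blast
qed

lemma complete_graph_cycle:
  assumes "finite V" "joined E V 1" "2 \<le> k" "k \<le> card V"
  obtains xs where "path E xs" "set xs \<subseteq> V" "length xs = k" "(last xs, hd xs) \<in> E"
proof -
  have adj: "(x, y) \<in> E" if "x \<in> V" "y \<in> V" "x \<noteq> y" for x y
    using joinedD[OF assms(2), of "{x}" "{y}"] that by simp
  obtain S where S: "S \<subseteq> V" "card S = k" by (meson assms(4) obtain_subset_with_card_n)
  then obtain xs where xs: "set xs = S" "distinct xs"
    using assms(1) finite_distinct_list finite_subset by metis
  have arcs: "distinct ys \<Longrightarrow> set ys \<subseteq> V \<Longrightarrow> set (vwalk_arcs ys) \<subseteq> E" for ys
    by (induction ys rule: vwalk_arcs.induct) (auto intro: adj)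
  have len: "length xs = k" using xs S distinct_card by metis
  then have "last xs \<noteq> hd xs" "xs \<noteq> []"
    using assms(3) xs(2) by (cases xs; auto)+
  then have "(last xs, hd xs) \<in> E" using xs(1) S(1) by (intro adj) auto
  then show thesis using that[of xs] xs S len arcs[of xs] by (auto simp: path_def)
qed

theorem theorem1p3:
  shows "\<exists>n0::nat. \<forall>n\<ge>n0. \<forall>t::real. t \<ge> 2 \<longrightarrow>
    (\<forall>G :: 'a pair_pre_digraph.
      pair_graph G \<and> card (pverts G) = n \<and>
      (\<forall>A B. A \<subseteq> pverts G \<and> B \<subseteq> pverts G \<and> A \<inter> B = {} \<and>
             real (card A) \<ge> real n / t \<and> real (card B) \<ge> real n / t \<longrightarrow>
             (\<exists>a\<in>A. \<exists>b\<in>B. (a, b) \<in> parcs G)) \<longrightarrow>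
      (\<forall>k::nat. k \<ge> 3 \<and>
             8 * real n * ln (real n) / (t * ln (ln (real n))) \<le> real k \<and>
             real k \<le> real n - 3 * real n / t \<longrightarrow>
             (\<exists>p. pre_digraph.cycle (with_proj G) p \<and> length p = k)))"
proof -
  have "eventually (\<lambda>n::nat. 4 \<le> ln (real n) / ln (ln (real n))) sequentially"
    by real_asymp
  then obtain n1 where n1: "\<And>n. n \<ge> n1 \<Longrightarrow> 4 \<le> ln (real n) / ln (ln (real n))"
    by (auto simp: eventually_sequentially)
  show ?thesis
  proof (intro exI[of _ "max n1 1"] allI impI)
    fix n :: nat and t :: real and G :: "'a pair_pre_digraph" and k :: nat
    assume n: "max n1 1 \<le> n" and t: "2 \<le> t"
      and G: "pair_graph G \<and> card (pverts G) = n \<and>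
      (\<forall>A B. A \<subseteq> pverts G \<and> B \<subseteq> pverts G \<and> A \<inter> B = {} \<and>
             real (card A) \<ge> real n / t \<and> real (card B) \<ge> real n / t \<longrightarrow>
             (\<exists>a\<in>A. \<exists>b\<in>B. (a, b) \<in> parcs G))"
      and k: "k \<ge> 3 \<and>
             8 * real n * ln (real n) / (t * ln (ln (real n))) \<le> real k \<and>
             real k \<le> real n - 3 * real n / t"
    interpret pair_graph G using G by simp
    define \<beta> where "\<beta> = real n / t"
    define m where "m = nat \<lceil>\<beta>\<rceil>"
    have \<beta>: "0 < \<beta>" using n t by (simp add: \<beta>_def)
    then have m: "\<beta> \<le> real m" "real m < \<beta> + 1" "0 < m"
      unfolding m_def by (simp, linarith, linarith)
    have "32 * \<beta> \<le> 8 * \<beta> * (ln (real n) / ln (ln (real n)))"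
      using mult_left_mono[OF n1[of n], of "8 * \<beta>"] n \<beta> by simp
    also have "\<dots> \<le> real k" using k by (simp add: \<beta>_def)
    finally have low: "32 * \<beta> \<le> real k" .
    have up: "real k + 3 * \<beta> \<le> real n" using k by (simp add: \<beta>_def)
    have joined: "joined (parcs G) (pverts G) m"
      unfolding joined_def
    proof (intro allI impI)
      fix A B :: "'a set"
      assume AB: "A \<subseteq> pverts G \<and> B \<subseteq> pverts G \<and> A \<inter> B = {} \<and> m \<le> card A \<and> m \<le> card B"
      then have "real n / t \<le> real (card A)" "real n / t \<le> real (card B)"
        using m(1) unfolding \<beta>_def by (metis of_nat_le_iff order_trans)+
      with AB G show "\<exists>a\<in>A. \<exists>b\<in>B. (a, b) \<in> parcs G" by blast
    qed
    have sym: "sym (parcs G)" using pair_sym_arcs by (simp add: symmetric_def)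
    have fin: "finite (pverts G)" by (rule pair_finite_verts)
    obtain xs where "path (parcs G) xs" "set xs \<subseteq> pverts G" "length xs = k"
      "(last xs, hd xs) \<in> parcs G"
    proof (cases "m = 1")
      case True
      have "k \<le> card (pverts G)" using up \<beta> G by simp
      with True show thesis
        using complete_graph_cycle[OF fin, of "parcs G" k] joined k that by auto
    next
      case False
      then have "2 \<le> m" using m(3) by simp
      then have "real m < 2 * \<beta>" using m(2) by linarith
      then have "14 * m < k" using low \<beta> by linarith
      moreover have "k + 3 * m \<le> card (pverts G) + 3" using up m(2) G by linarith
      ultimately show thesis
        using joined_graph_cycle[OF sym fin joined m(3)] that by blast
    qed
    moreover from this have "xs \<noteq> []" using k by auto
    ultimately show "\<exists>p. pre_digraph.cycle (with_proj G) p \<and> length p = k"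
      using cycle_of_path[of G xs] G by simp
  qed
qed

end
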